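(* Let $\mathcal{X}=\{X(n),\,n=0,1,\dots\}$ be a discrete-time birth-death process (random walk) on $\mathcal{N}=\{0,1,2,\dots\}$ with one-step transition probabilities $P_{j,j+1}=p_j$, $P_{j,j}=r_j$, $P_{j+1,j}=q_{j+1}$ (all other one-step transitions having probability $0$), where $p_j>0$, $q_{j+1}>0$, $r_j\ge 0$ and $p_j+q_j+r_j=1$ for all $j\ge 0$, with $q_0:=0$. Let $\pi_0:=1$ and $\pi_n:=\frac{p_0p_1\cdots p_{n-1}}{q_1q_2\cdots q_n}$ for $n\ge 1$. If \[\sum_{j\ge 0}\frac{1}{p_j\pi_j}\sum_{k=0}^j r_k\pi_k=\infty,\] then $\mathcal{X}$ possesses the strong ratio limit property, i.e. the limits \[\lim_{n\to\infty}\frac{P_{ij}(n)}{P_{kl}(n)},\qquad i,j,k,l\in\mathcal{N},\] all exist, where $P_{ij}(n)=\Pr\{X(n)=j\mid X(0)=i\}$ denotes the $n$-step transition probability.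
   Context: All notation is defined in the claim. *)

theory Defs
  imports "HOL-Analysis.Analysis"
begin

definition bd_step :: "(nat \<Rightarrow> real) \<Rightarrow> (nat \<Rightarrow> real) \<Rightarrow> (nat \<Rightarrow> real) \<Rightarrow> nat \<Rightarrow> nat \<Rightarrow> real" where
  "bd_step p q r i j =
     (if j = Suc i then p i else if j = i then r i else if Suc j = i then q i else 0)"

primrec nstep :: "(nat \<Rightarrow> nat \<Rightarrow> real) \<Rightarrow> nat \<Rightarrow> nat \<Rightarrow> nat \<Rightarrow> real" where
  "nstep P 0 i j = (if i = j then 1 else 0)"
| "nstep P (Suc n) i j = (\<Sum>k. nstep P n i k * P k j)"

definition bd_pi :: "(nat \<Rightarrow> real) \<Rightarrow> (nat \<Rightarrow> real) \<Rightarrow> nat \<Rightarrow> real" where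
  "bd_pi p q n = (\<Prod>i<n. p i) / (\<Prod>i\<in>{1..n}. q i)"

definition strong_ratio_limit :: "(nat \<Rightarrow> nat \<Rightarrow> real) \<Rightarrow> bool" where
  "strong_ratio_limit P \<longleftrightarrow>
     (\<forall>i j k l. convergent (\<lambda>n. nstep P n i j / nstep P n k l))"

end

theory Submission
  imports Defs "HOL-Probability.Characteristic_Functions"
begin

text \<open>
  Reversibility makes \<open>a n i j = P\<^sub>i\<^sub>j(n) / \<pi>\<^sub>j\<close> symmetric, and Cauchy--Schwarz makes the even return
  probabilities log-convex, so that \<open>m (2n + 2) / m (2n)\<close> increases to some \<open>\<rho>\<^sup>2 \<le> 1\<close>, where
  \<open>m n = P\<^sub>0\<^sub>0(n)\<close>.  With the birth-death polynomials \<open>Q\<^sub>i\<close>, a second use of Cauchy--Schwarz shows that,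
  up to \<open>o(1)\<close>, \<open>a (2n + s) i j / m (2n)\<close> equals
  \<open>\<alpha>\<^sub>n \<rho>\<^sup>s Q\<^sub>i(\<rho>) Q\<^sub>j(\<rho>) + \<beta>\<^sub>n (-\<rho>)\<^sup>s Q\<^sub>i(-\<rho>) Q\<^sub>j(-\<rho>)\<close> with weights \<open>\<alpha>\<^sub>n + \<beta>\<^sub>n = 1\<close>: the spectral
  measure of the \<open>2n\<close>-step chain concentrates at \<open>\<plusminus>\<rho>\<close>.  Since odd return probabilities to \<open>i\<close> are
  nonnegative, \<open>\<beta>\<^sub>n Q\<^sub>i(-\<rho>)\<^sup>2 \<le> \<alpha>\<^sub>n Q\<^sub>i(\<rho>)\<^sup>2 + o(1)\<close> for every \<open>i\<close>.  The divergent series forces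
  \<open>\<bar>Q\<^sub>i(-\<rho>)\<bar> / Q\<^sub>i(\<rho>) \<rightarrow> \<infinity>\<close>, hence \<open>\<beta>\<^sub>n \<rightarrow> 0\<close> and the ratio limits exist.
\<close>

section \<open>Birth-death polynomials, the chain and its reversing weights\<close>

text \<open>\<open>Q x\<close> is the column eigenvector of the transition matrix for the eigenvalue
  \<open>x\<close>, normalised to \<open>1\<close> at state \<open>0\<close>; the equations are the
  rows of the matrix solved for the highest entry.\<close>

fun bd_poly :: "(nat \<Rightarrow> real) \<Rightarrow> (nat \<Rightarrow> real) \<Rightarrow> (nat \<Rightarrow> real) \<Rightarrow> real \<Rightarrow> nat \<Rightarrow> real" where
  "bd_poly p q r x 0 = 1"
| "bd_poly p q r x (Suc 0) = (x - r 0) / p 0"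
| "bd_poly p q r x (Suc (Suc n)) =
     ((x - r (Suc n)) * bd_poly p q r x (Suc n) - q (Suc n) * bd_poly p q r x n) / p (Suc n)"

locale birth_death =
  fixes p q r :: "nat \<Rightarrow> real"
  assumes p_pos: "p j > 0"
    and q_pos: "q (Suc j) > 0"
    and r_nonneg: "r j \<ge> 0"
    and pqr_sum: "p j + q j + r j = 1"
    and q_0: "q 0 = 0"
begin

abbreviation "P \<equiv> nstep (bd_step p q r)"
abbreviation "\<pi> \<equiv> bd_pi p q"
abbreviation "Q \<equiv> bd_poly p q r"

text \<open>In the Karlin-McGregor representation this is the integral of
  \<open>x ^ n * Q x i * Q x j\<close> against the spectral measure, and \<open>m n\<close> is its
  \<open>n\<close>-th moment. The measure is never constructed; finite Gram sums replace it.\<close>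

definition a :: "nat \<Rightarrow> nat \<Rightarrow> nat \<Rightarrow> real" where
  "a n i j = P n i j / \<pi> j"

abbreviation m :: "nat \<Rightarrow> real" where
  "m n \<equiv> a n 0 0"

lemma q_nonneg: "q j \<ge> 0"
  using q_pos q_0 by (cases j) (auto intro: less_imp_le)

lemma pi_0 [simp]: "\<pi> 0 = 1"
  by (simp add: bd_pi_def)

lemma pi_pos: "\<pi> n > 0"
proof -
  have "q i > 0" if "i \<in> {1..n}" for i
    using q_pos[of "i - 1"] that by simp
  then show ?thesis
    unfolding bd_pi_def by (intro divide_pos_pos prod_pos) (auto simp: p_pos)
qed

lemma detailed_balance: "\<pi> (Suc n) * q (Suc n) = \<pi> n * p n"
proof -
  have "{1..Suc n} = insert (Suc n) {1..n}" by auto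
  then show ?thesis
    using q_pos[of n] by (simp add: bd_pi_def field_simps)
qed

lemma nstep_Suc:
  "P (Suc n) i j = (if j = 0 then 0 else P n i (j - 1) * p (j - 1)) + P n i j * r j
     + P n i (Suc j) * q (Suc j)"
proof -
  \<comment> \<open>For \<open>j = 0\<close> the set collapses to \<open>{0, 1}\<close>, so
    truncated subtraction counts nothing twice.\<close>
  have "P (Suc n) i j = (\<Sum>k\<in>{j - 1, j, Suc j}. P n i k * bd_step p q r k j)"
    unfolding nstep.simps by (rule suminf_finite) (auto simp: bd_step_def)
  then show ?thesis
    by (cases j) (auto simp: bd_step_def)
qed

section \<open>Recurrences, symmetry and Chapman-Kolmogorov for \<open>a\<close>\<close>

lemma a_0: "a 0 i j = (if i = j then 1 / \<pi> j else 0)"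
  by (simp add: a_def)

text \<open>At \<open>j = 0\<close> the truncated index \<open>j - 1\<close> is harmless because \<open>q 0 = 0\<close>.\<close>

lemma a_Suc: "a (Suc n) i j = q j * a n i (j - 1) + r j * a n i j + p j * a n i (Suc j)"
proof -
  have up: "q (Suc k) / \<pi> k = p k / \<pi> (Suc k)" for k
    using detailed_balance[of k] pi_pos[of k] pi_pos[of "Suc k"] by (simp add: field_simps)
  show ?thesis
  proof (cases j)
    case 0
    then show ?thesis
      using up[of 0] q_0 unfolding a_def nstep_Suc by (simp add: field_simps)
  next
    case (Suc k)
    have "P (Suc n) i j / \<pi> j
        = P n i k * (p k / \<pi> (Suc k)) + P n i j * r j / \<pi> j + P n i (Suc j) * (q (Suc j) / \<pi> j)"
      unfolding nstep_Suc Suc by (simp add: add_divide_distrib)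
    also have "\<dots> = P n i k * (q (Suc k) / \<pi> k) + P n i j * r j / \<pi> j
        + P n i (Suc j) * (p j / \<pi> (Suc j))"
      by (simp only: up)
    finally show ?thesis
      by (simp add: a_def Suc mult.commute)
  qed
qed

text \<open>The three-term operators in \<open>i\<close> and in \<open>j\<close> commute, so the
  induction step is a rearrangement; detailed balance enters only for \<open>n = 0\<close>.\<close>

lemma a_Suc': "a (Suc n) i j = q i * a n (i - 1) j + r i * a n i j + p i * a n (Suc i) j"
proof (induction n arbitrary: i j)
  case 0
  have up: "q (Suc k) / \<pi> k = p k / \<pi> (Suc k)" for k
    using detailed_balance[of k] pi_pos[of k] pi_pos[of "Suc k"] by (simp add: field_simps)
  show ?case
    unfolding a_Suc a_0 using up up[of 0, simplified] q_0 by (cases i; cases j) auto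
next
  case (Suc n)
  have "a (Suc (Suc n)) i j
      = q i * (q j * a n (i - 1) (j - 1) + r j * a n (i - 1) j + p j * a n (i - 1) (Suc j))
      + r i * (q j * a n i (j - 1) + r j * a n i j + p j * a n i (Suc j))
      + p i * (q j * a n (Suc i) (j - 1) + r j * a n (Suc i) j + p j * a n (Suc i) (Suc j))"
    unfolding a_Suc[of "Suc n"] Suc.IH by (simp add: algebra_simps)
  then show ?case
    unfolding a_Suc[of n, symmetric] .
qed

lemma a_sym: "a n i j = a n j i"
proof (induction n arbitrary: i j)
  case (Suc n)
  show ?case
    unfolding a_Suc[of n i j] a_Suc'[of n j i] by (simp add: Suc.IH)
qed (simp add: a_0)

lemma a_nonneg: "a n i j \<ge> 0"
proof (induction n arbitrary: j)
  case 0
  then show ?case using pi_pos[of j] by (simp add: a_0)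
next
  case (Suc n)
  then show ?case
    unfolding a_Suc by (intro add_nonneg_nonneg mult_nonneg_nonneg q_nonneg r_nonneg
        less_imp_le[OF p_pos])
qed

lemma a_le: "a n i j \<le> 1 / \<pi> j"
proof (induction n arbitrary: i)
  case 0
  then show ?case using pi_pos[of j] by (simp add: a_0)
next
  case (Suc n)
  have "a (Suc n) i j \<le> q i * (1 / \<pi> j) + r i * (1 / \<pi> j) + p i * (1 / \<pi> j)"
    unfolding a_Suc'
    by (intro add_mono mult_left_mono Suc q_nonneg r_nonneg less_imp_le[OF p_pos])
  also have "\<dots> = (p i + q i + r i) * (1 / \<pi> j)" by (simp only: distrib_right add_ac)
  finally show ?case by (simp only: pqr_sum mult_1)
qed

text \<open>Chapman-Kolmogorov as a finite sum: \<open>n\<close> steps from \<open>i\<close> cannot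
  lead beyond \<open>i + n\<close>.\<close>

lemma a_add:
  assumes "i + n \<le> N"
  shows "a (n + l) i j = (\<Sum>k\<le>N. \<pi> k * a n i k * a l k j)"
  using assms
proof (induction n arbitrary: i)
  case 0
  have "(\<Sum>k\<le>N. \<pi> k * a 0 i k * a l k j) = (\<Sum>k\<le>N. if k = i then a l i j else 0)"
    using pi_pos by (intro sum.cong) (auto simp: a_0 less_imp_neq[symmetric])
  then show ?case using 0 by simp
next
  case (Suc n)
  have "a (Suc n + l) i j = q i * a (n + l) (i - 1) j + r i * a (n + l) i j
      + p i * a (n + l) (Suc i) j"
    by (simp add: a_Suc')
  also have "\<dots> = (\<Sum>k\<le>N. \<pi> k * a (Suc n) i k * a l k j)"
    using Suc.prems
    by (simp add: Suc.IH a_Suc'[of n] sum_distrib_left sum.distrib distrib_left distrib_right mult_ac)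
  finally show ?case .
qed

section \<open>Even return probabilities and the decay parameter\<close>

text \<open>By Chapman-Kolmogorov and symmetry, \<open>m (u + v)\<close> is the
  \<open>\<pi>\<close>-weighted inner product of the rows \<open>a u 0\<close> and
  \<open>a v 0\<close>. The case \<open>d = 0\<close> gives log-convexity; the mixed case controls
  the odd moments.\<close>

lemma moment_Cauchy_Schwarz:
  "(c * m (x + y) + d * m (x + z))\<^sup>2
     \<le> m (2 * x) * (c\<^sup>2 * m (2 * y) + 2 * c * d * m (y + z) + d\<^sup>2 * m (2 * z))"
proof -
  define N where "N = x + y + z"
  have gram: "m (u + v) = (\<Sum>k\<le>N. \<pi> k * a u 0 k * a v 0 k)" if "u \<le> N" for u v
    using a_add[of 0 u N v 0] that by (simp add: a_sym[of v _ 0])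
  define f where "f k = sqrt (\<pi> k) * a x 0 k" for k
  define g where "g k = sqrt (\<pi> k) * (c * a y 0 k + d * a z 0 k)" for k
  have sq: "(sqrt (\<pi> k) * v) * (sqrt (\<pi> k) * v') = \<pi> k * (v * v')" for k v v'
  proof -
    have "(sqrt (\<pi> k) * v) * (sqrt (\<pi> k) * v') = (sqrt (\<pi> k) * sqrt (\<pi> k)) * (v * v')"
      by (simp only: mult_ac)
    then show ?thesis using pi_pos[of k] by simp
  qed
  have "(\<Sum>k\<le>N. f k * g k) = (\<Sum>k\<le>N. c * (\<pi> k * a x 0 k * a y 0 k) + d * (\<pi> k * a x 0 k * a z 0 k))"
    unfolding f_def g_def sq by (simp add: algebra_simps)
  also have "\<dots> = c * m (x + y) + d * m (x + z)"
    by (simp add: gram N_def sum.distrib sum_distrib_left)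
  finally have fg: "(\<Sum>k\<le>N. f k * g k) = c * m (x + y) + d * m (x + z)" .
  have "(\<Sum>k\<le>N. (f k)\<^sup>2) = (\<Sum>k\<le>N. \<pi> k * a x 0 k * a x 0 k)"
    unfolding f_def power2_eq_square sq by (simp add: mult.assoc)
  also have "\<dots> = m (2 * x)"
    using gram[of x x] by (simp add: N_def mult_2)
  finally have ff: "(\<Sum>k\<le>N. (f k)\<^sup>2) = m (2 * x)" .
  have "(\<Sum>k\<le>N. (g k)\<^sup>2) = (\<Sum>k\<le>N. c\<^sup>2 * (\<pi> k * a y 0 k * a y 0 k)
      + 2 * c * d * (\<pi> k * a y 0 k * a z 0 k) + d\<^sup>2 * (\<pi> k * a z 0 k * a z 0 k))"
    unfolding g_def power2_eq_square sq by (simp add: algebra_simps)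
  also have "\<dots> = c\<^sup>2 * m (y + y) + 2 * c * d * m (y + z) + d\<^sup>2 * m (z + z)"
    by (simp add: gram N_def sum.distrib sum_distrib_left)
  finally have gg: "(\<Sum>k\<le>N. (g k)\<^sup>2) = c\<^sup>2 * m (2 * y) + 2 * c * d * m (y + z) + d\<^sup>2 * m (2 * z)"
    unfolding mult_2[of y] mult_2[of z] .
  show ?thesis
    using Cauchy_Schwarz_ineq_sum[of f g "{..N}"] unfolding fg ff gg .
qed

text \<open>A return to \<open>0\<close> can be prolonged by the excursion \<open>0\<close>,
  \<open>1\<close>, \<open>0\<close>.\<close>

lemma moment_Suc_Suc_ge: "p 0 * q 1 * m n \<le> m (Suc (Suc n))"
proof -
  have "p 0 * (q 1 * m n) \<le> p 0 * a (Suc n) 0 1"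
    using p_pos[of 0] a_nonneg r_nonneg[of "Suc 0"] p_pos[of "Suc 0"]
    by (intro mult_left_mono) (auto simp: a_Suc[of n 0 "Suc 0"])
  also have "\<dots> \<le> m (Suc (Suc n))"
    using a_nonneg r_nonneg[of 0] by (simp add: a_Suc[of "Suc n" 0 0] q_0)
  finally show ?thesis by simp
qed

lemma moment_even_pos: "m (2 * n) > 0"
proof (induction n)
  case (Suc n)
  have "0 < p 0 * q 1 * m (2 * n)"
    using Suc p_pos[of 0] q_pos[of 0] by simp
  also have "\<dots> \<le> m (2 * Suc n)" using moment_Suc_Suc_ge[of "2 * n"] by simp
  finally show ?case .
qed (simp add: a_0)

definition ratio :: "nat \<Rightarrow> real" where
  "ratio n = m (2 * n + 2) / m (2 * n)"

text \<open>The decay parameter: \<open>m (2 * n)\<close> behaves like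
  \<open>\<rho> ^ (2 * n)\<close> up to subexponential factors. That the limit exists is part of
  \<open>ratio_tendsto\<close>.\<close>

definition \<rho> :: real where
  "\<rho> = sqrt (lim ratio)"

lemma incseq_ratio: "incseq ratio"
proof (rule incseq_SucI)
  fix n
  have idx: "n + (n + 2) = 2 * n + 2" "2 * (n + 2) = 2 * n + 4" "2 * Suc n = 2 * n + 2"
    "2 * n + 2 + 2 = 2 * n + 4" by simp_all
  have "(m (2 * n + 2))\<^sup>2 \<le> m (2 * n) * m (2 * n + 4)"
    using moment_Cauchy_Schwarz[of 1 n "n + 2" 0 0] unfolding idx by simp
  then show "ratio n \<le> ratio (Suc n)"
    using moment_even_pos[of n] moment_even_pos[of "Suc n"] unfolding ratio_def idx
    by (simp add: divide_simps power2_eq_square mult.commute)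
qed

text \<open>As the ratios increase, one ratio above \<open>1\<close> would make the even return
  probabilities grow geometrically past \<open>1\<close>.\<close>

lemma ratio_le_1: "ratio n \<le> 1"
proof (rule ccontr)
  assume "\<not> ratio n \<le> 1"
  then have gt: "ratio n > 1" by simp
  have "ratio n ^ k * m (2 * n) \<le> m (2 * (n + k))" for k
  proof (induction k)
    case (Suc k)
    have "ratio n ^ Suc k * m (2 * n) \<le> ratio n * m (2 * (n + k))"
      using Suc gt by simp
    also have "\<dots> \<le> ratio (n + k) * m (2 * (n + k))"
      using incseqD[OF incseq_ratio, of n "n + k"] moment_even_pos[of "n + k"] by simp
    also have "\<dots> = m (2 * (n + Suc k))"
      using moment_even_pos[of "n + k"] by (simp add: ratio_def)
    finally show ?case .
  qed simp
  moreover obtain k where "1 / m (2 * n) < ratio n ^ k"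
    using real_arch_pow[OF gt] by blast
  ultimately have "1 < m (2 * (n + k))"
    using moment_even_pos[of n] by (smt (verit) divide_less_eq)
  then show False
    using a_le[of "2 * (n + k)" 0 0] by simp
qed

lemma ratio_tendsto: "ratio \<longlonglongrightarrow> \<rho>\<^sup>2"
  and ratio_le: "ratio n \<le> \<rho>\<^sup>2"
  and \<rho>_pos: "\<rho> > 0"
  and \<rho>_le_1: "\<rho> \<le> 1"
proof -
  obtain l where l: "ratio \<longlonglongrightarrow> l" "\<And>n. ratio n \<le> l"
    using incseq_convergent[OF incseq_ratio, of 1] ratio_le_1 by blast
  have "0 < ratio 0"
    using moment_even_pos[of 0] moment_even_pos[of 1] by (simp add: ratio_def numeral_2_eq_2)
  then have l0: "l > 0" using l(2)[of 0] by simp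
  have l1: "l \<le> 1" using LIMSEQ_le_const2[OF l(1), of 1] ratio_le_1 by blast
  have "\<rho> = sqrt l" using limI[OF l(1)] by (simp add: \<rho>_def)
  then show "ratio \<longlonglongrightarrow> \<rho>\<^sup>2" "ratio n \<le> \<rho>\<^sup>2" "\<rho> > 0" "\<rho> \<le> 1"
    using l l0 l1 by auto
qed

section \<open>Odd return probabilities\<close>

text \<open>The weights \<alpha> and \<beta> of the overview are \<open>(1 + u n) / 2\<close> and
  \<open>(1 - u n) / 2\<close>.\<close>

definition u :: "nat \<Rightarrow> real" where
  "u n = m (2 * n + 1) / (\<rho> * m (2 * n))"

lemma u_nonneg: "u n \<ge> 0"
  using \<rho>_pos moment_even_pos[of n] by (simp add: u_def a_nonneg)

lemma u_le_1: "u n \<le> 1"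
proof -
  have idx: "n + (n + 1) = 2 * n + 1" "2 * (n + 1) = 2 * n + 2" by simp_all
  have "(m (2 * n + 1))\<^sup>2 \<le> m (2 * n) * m (2 * n + 2)"
    using moment_Cauchy_Schwarz[of 1 n "n + 1" 0 0] unfolding idx by simp
  also have "\<dots> = m (2 * n) * (ratio n * m (2 * n))"
    using moment_even_pos[of n] by (simp add: ratio_def)
  also have "\<dots> \<le> m (2 * n) * (\<rho>\<^sup>2 * m (2 * n))"
    using moment_even_pos[of n] by (intro mult_left_mono mult_right_mono ratio_le) auto
  also have "\<dots> = (\<rho> * m (2 * n))\<^sup>2" by (simp add: power2_eq_square)
  finally have "m (2 * n + 1) \<le> \<rho> * m (2 * n)"
    by (rule power2_le_imp_le) (use \<rho>_pos moment_even_pos[of n] in simp)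
  then show ?thesis
    using \<rho>_pos moment_even_pos[of n] by (simp add: u_def)
qed

lemma moment_even_tendsto: "(\<lambda>n. m (2 * n + 2 * t) / m (2 * n)) \<longlonglongrightarrow> \<rho> ^ (2 * t)"
proof (induction t)
  case 0
  then show ?case using moment_even_pos by (simp add: less_imp_neq[symmetric])
next
  case (Suc t)
  have "(\<lambda>n. ratio (n + t) * (m (2 * n + 2 * t) / m (2 * n))) \<longlonglongrightarrow> \<rho>\<^sup>2 * \<rho> ^ (2 * t)"
    by (intro tendsto_mult LIMSEQ_ignore_initial_segment ratio_tendsto Suc)
  moreover have "ratio (n + t) * (m (2 * n + 2 * t) / m (2 * n)) = m (2 * n + 2 * Suc t) / m (2 * n)" for n
    using moment_even_pos[of "n + t"] by (simp add: ratio_def algebra_simps)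
  ultimately have "(\<lambda>n. m (2 * n + 2 * Suc t) / m (2 * n)) \<longlonglongrightarrow> \<rho>\<^sup>2 * \<rho> ^ (2 * t)"
    by (simp only:)
  then show ?case by (simp add: power2_eq_square mult.assoc)
qed

text \<open>The numerator is the integral of
  \<open>x ^ (2 * n + 1) * (x\<^sup>2 - \<rho>\<^sup>2)\<close>. Cauchy-Schwarz bounds its square by
  \<open>m (2 * n + 2)\<close> times the integral of
  \<open>x ^ (2 * n) * (x\<^sup>2 - \<rho>\<^sup>2)\<^sup>2\<close>. Divided by
  \<open>m (2 * n)\<close>, this last integral tends to
  \<open>\<rho> ^ 4 - 2 * \<rho> ^ 4 + \<rho> ^ 4 = 0\<close>.\<close>

lemma moment_odd_step:
  "(\<lambda>n. (m (2 * n + 3) - \<rho>\<^sup>2 * m (2 * n + 1)) / m (2 * n)) \<longlonglongrightarrow> 0"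
proof -
  define e where "e n = m (2 * n + 2 * 1) / m (2 * n) * (m (2 * n + 2 * 2) / m (2 * n)
      - 2 * \<rho>\<^sup>2 * (m (2 * n + 2 * 1) / m (2 * n)) + (\<rho>\<^sup>2)\<^sup>2 * (m (2 * n + 2 * 0) / m (2 * n)))" for n
  have "e \<longlonglongrightarrow> \<rho> ^ (2 * 1) * (\<rho> ^ (2 * 2) - 2 * \<rho>\<^sup>2 * \<rho> ^ (2 * 1) + (\<rho>\<^sup>2)\<^sup>2 * \<rho> ^ (2 * 0))"
    unfolding e_def by (intro tendsto_intros moment_even_tendsto)
  then have "e \<longlonglongrightarrow> 0" by (simp add: eval_nat_numeral algebra_simps)
  then have "(\<lambda>n. sqrt (e n)) \<longlonglongrightarrow> 0"
    using tendsto_real_sqrt[of e 0] by simp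
  moreover have "\<bar>(m (2 * n + 3) - \<rho>\<^sup>2 * m (2 * n + 1)) / m (2 * n)\<bar> \<le> sqrt (e n)" for n
  proof -
    have idx: "n + 1 + (n + 2) = 2 * n + 3" "n + 1 + n = 2 * n + 1" "2 * (n + 1) = 2 * n + 2"
      "2 * (n + 2) = 2 * n + 4" "n + 2 + n = 2 * n + 2" by simp_all
    have sq: "(m (2 * n + 3) - \<rho>\<^sup>2 * m (2 * n + 1))\<^sup>2
        \<le> m (2 * n + 2) * (m (2 * n + 4) - 2 * \<rho>\<^sup>2 * m (2 * n + 2) + (\<rho>\<^sup>2)\<^sup>2 * m (2 * n))"
      using moment_Cauchy_Schwarz[of 1 "n + 1" "n + 2" "- \<rho>\<^sup>2" n] unfolding idx by simp
    have "((m (2 * n + 3) - \<rho>\<^sup>2 * m (2 * n + 1)) / m (2 * n))\<^sup>2 \<le> e n"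
    proof -
      have "e n = m (2 * n + 2) * (m (2 * n + 4) - 2 * \<rho>\<^sup>2 * m (2 * n + 2) + (\<rho>\<^sup>2)\<^sup>2 * m (2 * n))
          / (m (2 * n))\<^sup>2"
        using moment_even_pos[of n] by (simp add: e_def power2_eq_square field_simps)
      then show ?thesis
        using sq by (simp only: power_divide divide_right_mono zero_le_power2)
    qed
    then show ?thesis
      using real_le_rsqrt by (metis power2_abs)
  qed
  ultimately show ?thesis
    by - (rule Lim_null_comparison[where g = "\<lambda>n. sqrt (e n)"], simp_all)
qed

text \<open>Iterates the previous estimate. The claim concerns a difference because convergence of
  \<open>u\<close> is not yet known.\<close>

lemma moment_odd_tendsto:
  "(\<lambda>n. m (2 * n + 2 * t + 1) / m (2 * n) - u n * \<rho> ^ (2 * t + 1)) \<longlonglongrightarrow> 0"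
proof (induction t)
  case 0
  then show ?case using \<rho>_pos by (simp add: u_def)
next
  case (Suc t)
  define d where "d n = (m (2 * n + 3) - \<rho>\<^sup>2 * m (2 * n + 1)) / m (2 * n)" for n
  have "(\<lambda>n. d (n + t) * (m (2 * n + 2 * t) / m (2 * n))
      + \<rho>\<^sup>2 * (m (2 * n + 2 * t + 1) / m (2 * n) - u n * \<rho> ^ (2 * t + 1)))
      \<longlonglongrightarrow> 0 * \<rho> ^ (2 * t) + \<rho>\<^sup>2 * 0"
    using moment_odd_step unfolding d_def[symmetric]
    by (intro tendsto_intros LIMSEQ_ignore_initial_segment moment_even_tendsto Suc)
  moreover have "d (n + t) * (m (2 * n + 2 * t) / m (2 * n))
      + \<rho>\<^sup>2 * (m (2 * n + 2 * t + 1) / m (2 * n) - u n * \<rho> ^ (2 * t + 1))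
      = m (2 * n + 2 * Suc t + 1) / m (2 * n) - u n * \<rho> ^ (2 * Suc t + 1)" for n
  proof -
    have "d (n + t) * (m (2 * n + 2 * t) / m (2 * n))
        = (m (2 * n + 2 * Suc t + 1) - \<rho>\<^sup>2 * m (2 * n + 2 * t + 1)) / m (2 * n)"
    proof -
      have idx: "2 * n + 2 * t = 2 * (n + t)" "2 * n + 2 * Suc t + 1 = 2 * (n + t) + 3" by simp_all
      show ?thesis unfolding d_def idx using moment_even_pos[of "n + t"] by simp
    qed
    then show ?thesis
      by (simp add: diff_divide_distrib power2_eq_square algebra_simps)
  qed
  ultimately show ?case by simp
qed

section \<open>Two-point asymptotics\<close>

lemma poly_rec: "x * Q x n = q n * Q x (n - 1) + r n * Q x n + p n * Q x (Suc n)"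
proof (cases n)
  case 0
  then show ?thesis using p_pos[of 0] q_0 by (simp add: field_simps)
next
  case (Suc k)
  then show ?thesis using p_pos[of n] by (simp add: field_simps)
qed

declare bd_poly.simps(2,3) [simp del]

text \<open>The integral of \<open>x ^ s * Q x i * Q x j\<close> against the probability measure on
  \<open>\<rho>\<close> and \<open>- \<rho>\<close> whose mean is
  \<open>u n * \<rho>\<close>.\<close>

definition approx :: "nat \<Rightarrow> nat \<Rightarrow> nat \<Rightarrow> nat \<Rightarrow> real" where
  "approx s i j n = (1 + u n) / 2 * \<rho> ^ s * Q \<rho> i * Q \<rho> j
     + (1 - u n) / 2 * (- \<rho>) ^ s * Q (- \<rho>) i * Q (- \<rho>) j"

lemma approx_rec:
  "approx (Suc s) i j n = q i * approx s (i - 1) j n + r i * approx s i j n + p i * approx s (Suc i) j n"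
proof -
  have "approx (Suc s) i j n = (1 + u n) / 2 * \<rho> ^ s * (\<rho> * Q \<rho> i) * Q \<rho> j
     + (1 - u n) / 2 * (- \<rho>) ^ s * (- \<rho> * Q (- \<rho>) i) * Q (- \<rho>) j"
    by (simp add: approx_def mult_ac)
  then show ?thesis
    unfolding poly_rec[of _ i] by (simp add: approx_def algebra_simps)
qed

text \<open>Both terms obey the same recurrence in \<open>i\<close>, hence so does the error. Since
  \<open>p k > 0\<close>, rows \<open>k - 1\<close> and \<open>k\<close> determine row
  \<open>k + 1\<close>, at the price of raising \<open>s\<close>; the hypothesis is therefore needed
  for all \<open>s\<close>.\<close>

lemma approx_extend:
  assumes "\<And>s. (\<lambda>n. a (2 * n + s) 0 j / m (2 * n) - approx s 0 j n) \<longlonglongrightarrow> 0"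
  shows "(\<lambda>n. a (2 * n + s) i j / m (2 * n) - approx s i j n) \<longlonglongrightarrow> 0"
proof (induction i arbitrary: s rule: less_induct)
  case (less i)
  show ?case
  proof (cases i)
    case 0
    then show ?thesis using assms by simp
  next
    case (Suc k)
    define E where "E s i n = a (2 * n + s) i j / m (2 * n) - approx s i j n" for s i n
    have IH: "(\<lambda>n. E s k n) \<longlonglongrightarrow> 0" "(\<lambda>n. E s (k - 1) n) \<longlonglongrightarrow> 0" for s
      using less.IH[of k s] less.IH[of "k - 1" s] Suc by (simp_all add: E_def)
    have "(\<lambda>n. (E (Suc s) k n - r k * E s k n - q k * E s (k - 1) n) / p k)
        \<longlonglongrightarrow> (0 - r k * 0 - q k * 0) / p k"
      using p_pos[of k] by (intro tendsto_intros IH) simp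
    moreover have "E (Suc s) k n - r k * E s k n - q k * E s (k - 1) n = p k * E s i n" for n
      unfolding E_def approx_rec add_Suc_right a_Suc'
      by (simp add: Suc add_divide_distrib algebra_simps)
    ultimately show ?thesis using p_pos[of k] by (simp add: E_def)
  qed
qed

lemma approx_tendsto: "(\<lambda>n. a (2 * n + s) i j / m (2 * n) - approx s i j n) \<longlonglongrightarrow> 0"
proof -
  have base: "(\<lambda>n. m (2 * n + s) / m (2 * n) - approx s 0 0 n) \<longlonglongrightarrow> 0" for s
  proof (cases "even s")
    case True
    then obtain t where t: "s = 2 * t" by (elim evenE)
    have "approx s 0 0 n = \<rho> ^ s" for n
      using True by (simp add: approx_def field_simps)
    then show ?thesis
      using moment_even_tendsto[of t] unfolding t by (simp add: LIM_zero)
  next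
    case False
    then obtain t where t: "s = 2 * t + 1" by (elim oddE)
    have "approx s 0 0 n = u n * \<rho> ^ s" for n
      using False by (simp add: approx_def field_simps)
    then show ?thesis
      using moment_odd_tendsto[of t] unfolding t by simp
  qed
  \<comment> \<open>Extending in the first index and transposing by symmetry yields the row
    \<open>0\<close> hypothesis for a second extension.\<close>
  have "(\<lambda>n. a (2 * n + s) 0 i / m (2 * n) - approx s 0 i n) \<longlonglongrightarrow> 0" for s i
    using approx_extend[OF base, of s i] by (simp add: a_sym[of _ 0 i] approx_def mult.commute mult.left_commute)
  then show ?thesis by (rule approx_extend)
qed

section \<open>The polynomials at \<open>\<rho>\<close>\<close>

text \<open>Adding the case \<open>s = 1\<close> to \<open>\<rho>\<close> times the case
  \<open>s = 0\<close> cancels the contribution of \<open>- \<rho>\<close>. What remains,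
  \<open>(1 + u n) * \<rho> * Q \<rho> i\<close>, is within \<open>o(1)\<close> of a nonnegative
  quantity, and \<open>1 + u n \<ge> 1\<close>.\<close>

lemma poly_\<rho>_nonneg: "Q \<rho> i \<ge> 0"
proof (rule ccontr)
  assume neg: "\<not> Q \<rho> i \<ge> 0"
  have "(\<lambda>n. (a (2 * n + 1) i 0 / m (2 * n) - approx 1 i 0 n)
      + \<rho> * (a (2 * n + 0) i 0 / m (2 * n) - approx 0 i 0 n)) \<longlonglongrightarrow> 0 + \<rho> * 0"
    by (intro tendsto_intros approx_tendsto)
  moreover have "- (\<rho> * Q \<rho> i) \<le> (a (2 * n + 1) i 0 / m (2 * n) - approx 1 i 0 n)
      + \<rho> * (a (2 * n + 0) i 0 / m (2 * n) - approx 0 i 0 n)" for n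
  proof -
    have "approx 1 i 0 n + \<rho> * approx 0 i 0 n = (1 + u n) * (\<rho> * Q \<rho> i)"
      by (simp add: approx_def field_simps)
    also have "\<dots> \<le> 1 * (\<rho> * Q \<rho> i)"
      using neg \<rho>_pos u_nonneg[of n] by (intro mult_right_mono_neg) (auto simp: mult_le_0_iff)
    finally have "approx 1 i 0 n + \<rho> * approx 0 i 0 n \<le> \<rho> * Q \<rho> i" by simp
    moreover have "0 \<le> a (2 * n + 1) i 0 / m (2 * n) + \<rho> * (a (2 * n + 0) i 0 / m (2 * n))"
      using \<rho>_pos a_nonneg moment_even_pos[of n]
      by (intro add_nonneg_nonneg mult_nonneg_nonneg divide_nonneg_nonneg) auto
    ultimately show ?thesis by (simp add: algebra_simps)
  qed
  ultimately have "- (\<rho> * Q \<rho> i) \<le> 0 + \<rho> * 0"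
    by (intro LIMSEQ_le_const) auto
  then show False
    using neg \<rho>_pos by (simp add: zero_le_mult_iff)
qed

text \<open>A zero after a positive value would make the next value negative by the
  recurrence.\<close>

lemma poly_\<rho>_pos: "Q \<rho> i > 0"
proof (induction i)
  case (Suc i)
  have "Q \<rho> (Suc i) \<noteq> 0"
  proof
    assume "Q \<rho> (Suc i) = 0"
    then have "q (Suc i) * Q \<rho> i + p (Suc i) * Q \<rho> (Suc (Suc i)) = 0"
      using poly_rec[of \<rho> "Suc i"] by simp
    moreover have "q (Suc i) * Q \<rho> i > 0" using Suc q_pos by simp
    moreover have "p (Suc i) * Q \<rho> (Suc (Suc i)) \<ge> 0"
      using p_pos[of "Suc i"] poly_\<rho>_nonneg[of "Suc (Suc i)"] by simp
    ultimately show False by simp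
  qed
  then show ?case using poly_\<rho>_nonneg[of "Suc i"] by simp
qed simp

text \<open>As the rows sum to \<open>1\<close>, the recurrence for increments has the extra term
  \<open>(\<rho> - 1) * Q \<rho> k\<close>, which is nonpositive.\<close>

lemma decseq_poly_\<rho>: "decseq (Q \<rho>)"
proof (rule decseq_SucI)
  fix n
  show "Q \<rho> (Suc n) \<le> Q \<rho> n"
  proof (induction n)
    case 0
    have "p 0 + r 0 = 1" using pqr_sum[of 0] q_0 by simp
    then have "p 0 * Q \<rho> (Suc 0) \<le> p 0 * 1" using poly_rec[of \<rho> 0] q_0 \<rho>_le_1 by simp
    then show ?case using p_pos[of 0] by simp
  next
    case (Suc n)
    let ?k = "Suc n"
    have "p ?k * (Q \<rho> (Suc ?k) - Q \<rho> ?k)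
        = q ?k * (Q \<rho> ?k - Q \<rho> n) + (\<rho> - (p ?k + q ?k + r ?k)) * Q \<rho> ?k"
      using poly_rec[of \<rho> ?k] by (simp add: algebra_simps)
    also have "\<dots> \<le> 0"
    proof (rule add_nonpos_nonpos)
      show "q ?k * (Q \<rho> ?k - Q \<rho> n) \<le> 0"
        using Suc q_nonneg[of ?k] by (simp add: mult_nonneg_nonpos)
      show "(\<rho> - (p ?k + q ?k + r ?k)) * Q \<rho> ?k \<le> 0"
        unfolding pqr_sum using \<rho>_le_1 poly_\<rho>_nonneg[of ?k] by (simp add: mult_nonpos_nonneg)
    qed
    finally show ?case using p_pos[of ?k] by (simp add: mult_le_0_iff)
  qed
qed

section \<open>Growth of the polynomials at \<open>- \<rho>\<close>\<close>

text \<open>The sign factor compensates the alternation of \<open>Q (- \<rho>) n\<close>; by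
  \<open>w_ge_1\<close> below, \<open>w n\<close> is the quotient of absolute values from the
  overview.\<close>

definition w :: "nat \<Rightarrow> real" where
  "w n = (-1) ^ n * Q (- \<rho>) n / Q \<rho> n"

text \<open>The Casoratian of \<open>Q\<^sub>n(\<rho>)\<close> and \<open>(-1)\<^sup>n Q\<^sub>n(-\<rho>)\<close>; both satisfy the same recurrence up to the sign
  of \<open>r\<^sub>n\<close>.\<close>

lemma w_diff:
  "w (Suc n) - w n = 2 / (p n * \<pi> n * Q \<rho> n * Q \<rho> (Suc n))
     * (\<Sum>k\<le>n. r k * \<pi> k * (Q \<rho> k)\<^sup>2 * w k)"
proof -
  define R where "R k = (-1) ^ k * Q (- \<rho>) k" for k
  have R0: "p 0 * R (Suc 0) = (\<rho> + r 0) * R 0"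
    using poly_rec[of "- \<rho>" 0] q_0 by (simp add: R_def)
  have R: "p (Suc k) * R (Suc (Suc k)) = (\<rho> + r (Suc k)) * R (Suc k) - q (Suc k) * R k" for k
  proof -
    have "p (Suc k) * R (Suc (Suc k)) = (-1) ^ k * (p (Suc k) * Q (- \<rho>) (Suc (Suc k)))"
      by (simp add: R_def)
    also have "p (Suc k) * Q (- \<rho>) (Suc (Suc k))
        = - \<rho> * Q (- \<rho>) (Suc k) - q (Suc k) * Q (- \<rho>) k - r (Suc k) * Q (- \<rho>) (Suc k)"
      using poly_rec[of "- \<rho>" "Suc k"] by simp
    finally show ?thesis by (simp add: R_def algebra_simps)
  qed
  have Q0: "p 0 * Q \<rho> (Suc 0) = (\<rho> - r 0) * Q \<rho> 0"
    using poly_rec[of \<rho> 0] q_0 by simp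
  have Q: "p (Suc k) * Q \<rho> (Suc (Suc k)) = (\<rho> - r (Suc k)) * Q \<rho> (Suc k) - q (Suc k) * Q \<rho> k" for k
    using poly_rec[of \<rho> "Suc k"] by (simp add: algebra_simps)
  have Qw: "(Q \<rho> k)\<^sup>2 * w k = R k * Q \<rho> k" for k
    using poly_\<rho>_pos[of k] by (simp add: w_def R_def power2_eq_square)
  have cas: "\<pi> n * p n * (R (Suc n) * Q \<rho> n - R n * Q \<rho> (Suc n))
      = 2 * (\<Sum>k\<le>n. r k * \<pi> k * (R k * Q \<rho> k))"
  proof (induction n)
    case 0
    have "\<pi> 0 * p 0 * (R (Suc 0) * Q \<rho> 0 - R 0 * Q \<rho> (Suc 0))
        = (p 0 * R (Suc 0)) * Q \<rho> 0 - R 0 * (p 0 * Q \<rho> (Suc 0))"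
      by (simp add: algebra_simps)
    also have "\<dots> = 2 * (r 0 * (R 0 * Q \<rho> 0))"
      unfolding R0 Q0 by algebra
    finally show ?case by simp
  next
    case (Suc n)
    let ?k = "Suc n"
    have "\<pi> ?k * p ?k * (R (Suc ?k) * Q \<rho> ?k - R ?k * Q \<rho> (Suc ?k))
        = \<pi> ?k * ((p ?k * R (Suc ?k)) * Q \<rho> ?k - R ?k * (p ?k * Q \<rho> (Suc ?k)))"
      by (simp add: algebra_simps)
    \<comment> \<open>The \<open>\<rho>\<close> parts cancel, while the \<open>r\<close> parts have
      opposite signs and double. Detailed balance then turns the \<open>q\<close> part into the
      preceding Casoratian.\<close>
    also have "\<dots> = 2 * (r ?k * \<pi> ?k * (R ?k * Q \<rho> ?k))
        + (\<pi> ?k * q ?k) * (R ?k * Q \<rho> n - R n * Q \<rho> ?k)"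
      unfolding R Q by algebra
    also have "\<dots> = 2 * (\<Sum>k\<le>?k. r k * \<pi> k * (R k * Q \<rho> k))"
      unfolding detailed_balance Suc.IH by (simp add: algebra_simps)
    finally show ?case .
  qed
  have "w (Suc n) - w n = (R (Suc n) * Q \<rho> n - R n * Q \<rho> (Suc n)) / (Q \<rho> n * Q \<rho> (Suc n))"
    using poly_\<rho>_pos[of n] poly_\<rho>_pos[of "Suc n"]
    by (simp add: w_def R_def[symmetric] field_simps del: power_Suc)
  also have "\<dots> = \<pi> n * p n * (R (Suc n) * Q \<rho> n - R n * Q \<rho> (Suc n)) / (p n * \<pi> n * Q \<rho> n * Q \<rho> (Suc n))"
    using p_pos[of n] pi_pos[of n] by simp
  finally show ?thesis
    unfolding cas by (simp add: mult.assoc Qw)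
qed

text \<open>\<open>w 0 = 1\<close>, and the increments are nonnegative as long as all earlier values
  are.\<close>

lemma w_ge_1: "w n \<ge> 1"
proof (induction n rule: less_induct)
  case (less n)
  show ?case
  proof (cases n)
    case 0
    then show ?thesis by (simp add: w_def)
  next
    case (Suc k)
    have "0 \<le> w l" if "l \<le> k" for l
      using less.IH[of l] that Suc by simp
    then have "0 \<le> w (Suc k) - w k"
      unfolding w_diff
      by (intro mult_nonneg_nonneg divide_nonneg_nonneg sum_nonneg)
        (auto simp: r_nonneg less_imp_le[OF pi_pos] less_imp_le[OF p_pos] poly_\<rho>_nonneg)
    then show ?thesis using less.IH[of k] Suc by simp
  qed
qed

text \<open>Monotonicity of \<open>Q \<rho>\<close> and \<open>w k \<ge> 1\<close> bound each
  \<open>(Q \<rho> k)\<^sup>2 * w k\<close> below by \<open>Q \<rho> n * Q \<rho> (Suc n)\<close>,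
  which cancels the denominator in \<open>w_diff\<close>.\<close>

lemma w_diff_ge:
  "2 * ((1 / (p n * \<pi> n)) * (\<Sum>k\<le>n. r k * \<pi> k)) \<le> w (Suc n) - w n"
proof -
  define D where "D = Q \<rho> n * Q \<rho> (Suc n)"
  have D: "D > 0" unfolding D_def by (intro mult_pos_pos poly_\<rho>_pos)
  have "r k * \<pi> k * D \<le> r k * \<pi> k * (Q \<rho> k)\<^sup>2 * w k" if "k \<le> n" for k
  proof -
    have "D \<le> Q \<rho> k * Q \<rho> k"
      unfolding D_def using decseqD[OF decseq_poly_\<rho>] that poly_\<rho>_nonneg by (intro mult_mono) auto
    also have "\<dots> \<le> Q \<rho> k * Q \<rho> k * w k"
      using mult_left_mono[OF w_ge_1[of k], of "Q \<rho> k * Q \<rho> k"] by simp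
    finally have "r k * \<pi> k * D \<le> r k * \<pi> k * (Q \<rho> k * Q \<rho> k * w k)"
      using r_nonneg[of k] pi_pos[of k] by (intro mult_left_mono) auto
    then show ?thesis by (simp add: power2_eq_square mult.assoc)
  qed
  then have "(\<Sum>k\<le>n. r k * \<pi> k) * D \<le> (\<Sum>k\<le>n. r k * \<pi> k * (Q \<rho> k)\<^sup>2 * w k)"
    unfolding sum_distrib_right by (intro sum_mono) auto
  then have "2 / (p n * \<pi> n * D) * ((\<Sum>k\<le>n. r k * \<pi> k) * D) \<le> w (Suc n) - w n"
    unfolding w_diff using D p_pos[of n] pi_pos[of n]
    by (simp only: mult.assoc D_def[symmetric]) (intro mult_left_mono, auto)
  then show ?thesis
    using D by simp
qed

lemma w_unbounded:
  assumes "\<not> summable (\<lambda>j. (1 / (p j * \<pi> j)) * (\<Sum>k\<le>j. r k * \<pi> k))"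
  shows "\<exists>n. w n > B"
proof (rule ccontr)
  let ?f = "\<lambda>j. (1 / (p j * \<pi> j)) * (\<Sum>k\<le>j. r k * \<pi> k)"
  assume "\<not> (\<exists>n. w n > B)"
  then have B: "w n \<le> B" for n by (simp add: not_less)
  have "(\<Sum>j<n. ?f j) \<le> B" for n
  proof -
    have "2 * (\<Sum>j<n. ?f j) = (\<Sum>j<n. 2 * ?f j)" by (rule sum_distrib_left)
    also have "\<dots> \<le> (\<Sum>j<n. w (Suc j) - w j)" by (intro sum_mono w_diff_ge)
    also have "\<dots> = w n - w 0" by (rule sum_lessThan_telescope)
    finally show ?thesis using B[of n] w_ge_1[of 0] w_ge_1[of n] by linarith
  qed
  moreover have "?f j \<ge> 0" for j
    using p_pos[of j] pi_pos r_nonneg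
    by (intro mult_nonneg_nonneg sum_nonneg) (auto simp: less_imp_le)
  ultimately have "summable ?f"
    by (intro summableI_nonneg_bounded[where x = B])
  then show False using assms by contradiction
qed

section \<open>Concentration at \<open>\<rho>\<close> and the ratio limits\<close>

lemma u_tendsto_1:
  assumes "\<not> summable (\<lambda>j. (1 / (p j * \<pi> j)) * (\<Sum>k\<le>j. r k * \<pi> k))"
  shows "u \<longlonglongrightarrow> 1"
proof (rule LIMSEQ_I)
  fix e :: real
  assume e: "e > 0"
  \<comment> \<open>The bound derived below is \<open>(1 - u n) * (w i)\<^sup>2 < 4\<close>, and
    \<open>w i \<le> (w i)\<^sup>2\<close>; hence the threshold \<open>4 / e\<close>.\<close>
  obtain i where i: "w i > 4 / e" using w_unbounded[OF assms] by blast
  let ?x = "Q \<rho> i" and ?y = "Q (- \<rho>) i"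
  have x: "?x > 0" by (rule poly_\<rho>_pos)
  have "(w i)\<^sup>2 = ?y\<^sup>2 / ?x\<^sup>2"
    by (simp add: w_def power_divide power_mult_distrib flip: power_mult)
  then have y: "?y\<^sup>2 = (w i)\<^sup>2 * ?x\<^sup>2" using x by simp
  have "w i * 1 \<le> (w i)\<^sup>2"
    unfolding power2_eq_square using w_ge_1[of i] by (intro mult_left_mono) auto
  then have W: "(w i)\<^sup>2 > 4 / e" using i by simp
  define E where "E n = a (2 * n + 1) i i / m (2 * n) - approx 1 i i n" for n
  have "E \<longlonglongrightarrow> 0" unfolding E_def by (rule approx_tendsto)
  \<comment> \<open>The error margin is a multiple of \<open>\<rho> * ?x\<^sup>2\<close> so that
    this factor can be divided out of the whole inequality.\<close>
  then obtain N where N: "E n < \<rho> * ?x\<^sup>2" if "n \<ge> N" for n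
    using order_tendstoD(2)[of E 0 sequentially "\<rho> * ?x\<^sup>2"] x \<rho>_pos
    unfolding eventually_sequentially by auto
  show "\<exists>N. \<forall>n\<ge>N. norm (u n - 1) < e"
  proof (intro exI[of _ N] allI impI)
    fix n assume n: "n \<ge> N"
    have "0 \<le> a (2 * n + 1) i i / m (2 * n)"
      using a_nonneg moment_even_pos[of n] by simp
    also have "\<dots> = E n + approx 1 i i n" by (simp add: E_def)
    also have "\<dots> < \<rho> * ?x\<^sup>2 + approx 1 i i n" using N[OF n] by simp
    also have "\<dots> = \<rho> * ?x\<^sup>2 * (1 + (1 + u n) / 2 - (1 - u n) / 2 * (w i)\<^sup>2)"
    proof -
      have "approx 1 i i n = (1 + u n) / 2 * \<rho> * ?x\<^sup>2 - (1 - u n) / 2 * \<rho> * ?y\<^sup>2"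
        by (simp add: approx_def power2_eq_square)
      then show ?thesis unfolding y by (simp add: algebra_simps)
    qed
    finally have "0 < 1 + (1 + u n) / 2 - (1 - u n) / 2 * (w i)\<^sup>2"
      by (rule zero_less_mult_pos) (use x \<rho>_pos in simp)
    then have "(1 - u n) * (w i)\<^sup>2 < 4"
      using u_le_1[of n] by (simp add: field_simps)
    moreover have "(1 - u n) * (4 / e) \<le> (1 - u n) * (w i)\<^sup>2"
      using W u_le_1[of n] by (intro mult_left_mono) auto
    ultimately have "(1 - u n) * (4 / e) < 4" by linarith
    then show "norm (u n - 1) < e"
      using e u_le_1[of n] by (simp add: field_simps)
  qed
qed

lemma a_ratio_tendsto:
  assumes "u \<longlonglongrightarrow> 1"
  shows "(\<lambda>n. a (2 * n + s) i j / m (2 * n)) \<longlonglongrightarrow> \<rho> ^ s * Q \<rho> i * Q \<rho> j"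
proof -
  have "approx s i j \<longlonglongrightarrow> (1 + 1) / 2 * \<rho> ^ s * Q \<rho> i * Q \<rho> j
      + (1 - 1) / 2 * (- \<rho>) ^ s * Q (- \<rho>) i * Q (- \<rho>) j"
    unfolding approx_def by (intro tendsto_intros assms) auto
  from tendsto_add[OF approx_tendsto[of s i j] this] show ?thesis by simp
qed

text \<open>The factor \<open>\<rho> ^ s\<close> cancels in the quotient, so the even and the odd
  subsequence share one limit.\<close>

lemma strong_ratio_limit:
  assumes "\<not> summable (\<lambda>j. (1 / (p j * \<pi> j)) * (\<Sum>k\<le>j. r k * \<pi> k))"
  shows "strong_ratio_limit (bd_step p q r)"
  unfolding strong_ratio_limit_def
proof (intro allI)
  fix i j k l
  define L where "L = (\<pi> j * (Q \<rho> i * Q \<rho> j)) / (\<pi> l * (Q \<rho> k * Q \<rho> l))"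
  have sub: "(\<lambda>n. P (2 * n + s) i j / P (2 * n + s) k l) \<longlonglongrightarrow> L" for s
  proof -
    have "(\<lambda>n. (\<pi> j * (a (2 * n + s) i j / m (2 * n))) / (\<pi> l * (a (2 * n + s) k l / m (2 * n))))
        \<longlonglongrightarrow> (\<pi> j * (\<rho> ^ s * Q \<rho> i * Q \<rho> j)) / (\<pi> l * (\<rho> ^ s * Q \<rho> k * Q \<rho> l))"
      using poly_\<rho>_pos[of k] poly_\<rho>_pos[of l] \<rho>_pos pi_pos[of l]
      by (intro tendsto_intros a_ratio_tendsto u_tendsto_1 assms) simp
    \<comment> \<open>This includes those \<open>n\<close> where the denominator vanishes: both
      sides are then \<open>0\<close>.\<close>
    moreover have "(\<pi> j * (a (2 * n + s) i j / m (2 * n))) / (\<pi> l * (a (2 * n + s) k l / m (2 * n)))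
        = P (2 * n + s) i j / P (2 * n + s) k l" for n
      using moment_even_pos[of n] pi_pos[of j] pi_pos[of l] unfolding a_def by simp
    ultimately show ?thesis
      using \<rho>_pos by (simp add: L_def mult.assoc mult.left_commute[of _ "\<rho> ^ s"])
  qed
  have "(\<lambda>n. P n i j / P n k l) \<longlonglongrightarrow> L"
    by (rule limseq_even_odd) (use sub[of 0] sub[of 1] in simp_all)
  then show "convergent (\<lambda>n. P n i j / P n k l)" by (rule convergentI)
qed

end

theorem theorem1:
  fixes p q r :: "nat \<Rightarrow> real"
  assumes "\<And>j. p j > 0"
    and "\<And>j. q (Suc j) > 0"
    and "\<And>j. r j \<ge> 0"
    and "\<And>j. p j + q j + r j = 1"
    and "q 0 = 0"
    and "\<not> summable (\<lambda>j. (1 / (p j * bd_pi p q j)) * (\<Sum>k\<le>j. r k * bd_pi p q k))"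
  shows "strong_ratio_limit (bd_step p q r)"
proof -
  interpret birth_death p q r
    using assms(1-5) by unfold_locales
  show ?thesis using assms(6) by (rule strong_ratio_limit)
qed

end
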